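(* Fix an integer $d\ge 3$, a real $\delta\in(-\infty,d-1)$ and $c\in(0,\infty)$, let $p=(c+o_n(1))n^{-d+1+\delta}$, and let $\mathcal{H}$ be the random $d$-uniform hypergraph on $[n]$ in which each $d$-subset is a hyperedge independently with probability $p$. If $\delta<\frac{d-1}{d+1}$ then the weighted partial recovery loss is $o_n(1)$, and if $\delta>\frac{d-1}{d+1}$ then the weighted partial recovery loss is $1-o_n(1)$.
   Context: The weighted projection $\mathrm{Proj}_W(H)$ of a $d$-uniform hypergraph $H$ on $[n]$ is the edge-weighted graph on $[n]$ in which the weight of $\{i,j\}$ ($i\ne j$) equals the number of hyperedges of $H$ containing $\{i,j\}$. Let $\mathcal{G}_W$ be the set of such weighted projections. For a function $\mathcal{B}_W:\mathcal{G}_W\to\{0,1\}^{\binom{[n]}{d}}$, its loss is $\ell_W(\mathcal{B}_W)=\mathbb{E}[|\mathcal{B}_W(\mathrm{Proj}_W(\mathcal{H}))\,\Delta\,E(\mathcal{H})|]/(p\binom{n}{d})$. The weighted partial recovery loss is the minimum of $\ell_W$ over all such functions. Asymptotics are as $n\to\infty$ with $d,\delta,c$ fixed. *)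

theory Defs
  imports "HOL-Probability.Probability" "HOL-Library.Ramsey"
begin

text \<open>A \<open>d\<close>-uniform hypergraph on \<open>[n] = {1..n}\<close> is identified with its edge set, a subset of
  \<^term>\<open>nsets {1..n} d\<close>; likewise \<open>{0,1}\<close>-vectors indexed by the \<open>d\<close>-subsets of \<open>[n]\<close> are
  identified with subsets of \<^term>\<open>nsets {1..n} d\<close>.  An edge-weighted graph on \<open>[n]\<close> is an
  extensional function on \<^term>\<open>nsets {1..n} 2\<close>, so that equal weighted graphs are equal
  functions.\<close>

type_synonym hypergraph = "nat set set"
type_synonym weighted_graph = "nat set \<Rightarrow> nat"

definition proj_W :: "nat \<Rightarrow> hypergraph \<Rightarrow> weighted_graph" where
  "proj_W n H = (\<lambda>e \<in> nsets {1..n} 2. card {h \<in> H. e \<subseteq> h})"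

definition weighted_projections :: "nat \<Rightarrow> nat \<Rightarrow> weighted_graph set" where
  "weighted_projections n d = proj_W n ` Pow (nsets {1..n} d)"

text \<open>\<^const>\<open>bernoulli_pmf\<close> clamps its parameter to \<open>[0,1]\<close>; this is the identity on genuine
  probabilities.\<close>

definition random_hypergraph :: "nat \<Rightarrow> nat \<Rightarrow> real \<Rightarrow> hypergraph pmf" where
  "random_hypergraph n d p =
     map_pmf (\<lambda>f. {h \<in> nsets {1..n} d. f h})
       (Pi_pmf (nsets {1..n} d) False (\<lambda>_. bernoulli_pmf p))"

definition loss_W :: "nat \<Rightarrow> nat \<Rightarrow> real \<Rightarrow> (weighted_graph \<Rightarrow> hypergraph) \<Rightarrow> real" where
  "loss_W n d p B =
     measure_pmf.expectation (random_hypergraph n d p)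
       (\<lambda>H. real (card (sym_diff (B (proj_W n H)) H))) / (p * real (n choose d))"

definition estimators_W :: "nat \<Rightarrow> nat \<Rightarrow> (weighted_graph \<Rightarrow> hypergraph) set" where
  "estimators_W n d = weighted_projections n d \<rightarrow>\<^sub>E Pow (nsets {1..n} d)"

definition partial_recovery_loss_W :: "nat \<Rightarrow> nat \<Rightarrow> real \<Rightarrow> real" where
  "partial_recovery_loss_W n d p = Min (loss_W n d p ` estimators_W n d)"

text \<open>The minimum is taken over a finite nonempty set, hence is attained.\<close>

lemma finite_estimators_W: "finite (estimators_W n d)"
  unfolding estimators_W_def weighted_projections_def
  by (intro finite_PiE) (auto simp: finite_imp_finite_nsets)

lemma estimators_W_nonempty: "estimators_W n d \<noteq> {}"
  unfolding estimators_W_def by (auto simp: PiE_eq_empty_iff)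

end

theory Submission imports Defs begin

text \<open>Below the threshold, the estimator that outputs every \<open>d\<close>-set all of whose pairs have positive
  weight works: if a non-edge \<open>h\<close> is output, its pairs are covered by the traces on \<open>h\<close> of other
  hyperedges, a trace of size \<open>k\<close> appears with probability of order at most \<open>n powr - (k - 1 - \<delta>)\<close>, and for
  \<open>\<delta> < (d - 1) / (d + 1)\<close> the costs \<open>k - 1 - \<delta>\<close> of any family of proper traces covering all pairs of \<open>h\<close>
  add up to strictly more than \<open>d - 1 - \<delta>\<close>, the cost of \<open>h\<close> itself.

  Above the threshold, every estimator \<open>B\<close> is turned into a code for hypergraphs: encode the
  projected weights by independent geometric distributions of mean \<open>n powr - \<kappa>\<close>, \<open>\<kappa> = max (1 - \<delta>) 0\<close>, and then
  each \<open>d\<close>-set independently, declaring it a hyperedge with probability \<open>1/2\<close> if it is output by \<open>B\<close>,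
  with probability \<open>n powr - \<gamma>\<close> if it is not but all its pairs have positive weight, and with
  probability \<open>0\<close> otherwise, where \<open>\<gamma> = d - 1 - \<delta> - (d choose 2) * \<kappa>\<close>.  By Gibbs' inequality the expected
  code length is at least the entropy.  With \<open>m\<close> the expected number of hyperedges, the entropy minus
  the cost of the weights is at least \<open>m * \<gamma> * ln n - O(m)\<close>, whereas the remaining part of the code
  costs \<open>\<gamma> * ln n\<close> for each missed hyperedge and \<open>O(1)\<close> for each member of \<open>B\<close>.  Hence the loss is at
  least \<open>1 - O(1 / ln n)\<close>.\<close>

section \<open>Binomial random subsets\<close>

definition subset_prob :: "'a set \<Rightarrow> real \<Rightarrow> 'a set \<Rightarrow> real" where
  "subset_prob S p H = p ^ card H * (1 - p) ^ card (S - H)"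

text \<open>Finite sums replace integrals, so that union bounds and Gibbs' inequality become
  statements about sums; \<open>expectation_random_hypergraph\<close> gives the link.\<close>

definition subset_expect :: "'a set \<Rightarrow> real \<Rightarrow> ('a set \<Rightarrow> real) \<Rightarrow> real" where
  "subset_expect S p f = (\<Sum>H\<in>Pow S. subset_prob S p H * f H)"

lemma subset_prob_nonneg: "0 \<le> p \<Longrightarrow> p \<le> 1 \<Longrightarrow> 0 \<le> subset_prob S p H"
  by (simp add: subset_prob_def)

lemma subset_expect_mono:
  assumes "0 \<le> p" "p \<le> 1" "\<And>H. H \<subseteq> S \<Longrightarrow> f H \<le> g H"
  shows "subset_expect S p f \<le> subset_expect S p g"
  unfolding subset_expect_def
  using assms by (intro sum_mono mult_left_mono subset_prob_nonneg) auto

lemma subset_expect_add: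
  "subset_expect S p (\<lambda>H. f H + g H) = subset_expect S p f + subset_expect S p g"
  by (simp add: subset_expect_def distrib_left sum.distrib)

lemma subset_expect_cmult: "subset_expect S p (\<lambda>H. a * f H) = a * subset_expect S p f"
  by (simp add: subset_expect_def sum_distrib_left mult_ac)

lemma subset_expect_sum:
  "subset_expect S p (\<lambda>H. \<Sum>i\<in>I. f i H) = (\<Sum>i\<in>I. subset_expect S p (f i))"
  unfolding subset_expect_def sum_distrib_left by (rule sum.swap)

text \<open>The indicator of \<open>G \<subseteq> H\<close> is a product over \<open>S - H\<close>
  in which elements of \<open>G\<close> contribute 0. Summing over \<open>H\<close> expands a
  product over \<open>S\<close>, where elements of \<open>G\<close> give \<open>p\<close> and all
  others give 1.\<close>

lemma subset_expect_superset:
  assumes "finite S" "G \<subseteq> S"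
  shows "subset_expect S p (\<lambda>H. of_bool (G \<subseteq> H)) = p ^ card G"
proof -
  have "subset_expect S p (\<lambda>H. of_bool (G \<subseteq> H))
      = (\<Sum>H\<in>Pow S. (\<Prod>x\<in>H. p) * (\<Prod>x\<in>S - H. (1 - p) * of_bool (x \<notin> G)))"
    unfolding subset_expect_def
  proof (rule sum.cong)
    fix H assume "H \<in> Pow S"
    have "(\<Prod>x\<in>S - H. of_bool (x \<notin> G)) = (of_bool (G \<subseteq> H) :: real)"
    proof (cases "G \<subseteq> H")
      case False
      then obtain x where "x \<in> G" "x \<notin> H" by blast
      then show ?thesis using assms by (auto intro!: prod_zero)
    qed (auto intro!: prod.neutral)
    then show "subset_prob S p H * of_bool (G \<subseteq> H) =
        (\<Prod>x\<in>H. p) * (\<Prod>x\<in>S - H. (1 - p) * of_bool (x \<notin> G))"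
      by (simp add: prod.distrib subset_prob_def)
  qed simp
  also have "\<dots> = (\<Prod>x\<in>S. p + (1 - p) * of_bool (x \<notin> G))"
    using assms by (simp add: prod_add)
  also have "\<dots> = (\<Prod>x\<in>G. p + (1 - p) * of_bool (x \<notin> G))"
    using assms by (intro prod.mono_neutral_right) auto
  also have "\<dots> = p ^ card G" by simp
  finally show ?thesis .
qed

lemma subset_expect_const: "finite S \<Longrightarrow> subset_expect S p (\<lambda>_. a) = a"
  using subset_expect_cmult[of S p a "\<lambda>_. 1"] subset_expect_superset[of S "{}" p] by simp

lemma subset_expect_card:
  assumes "finite S"
  shows "subset_expect S p (\<lambda>H. real (card H)) = real (card S) * p"
proof -
  have "subset_expect S p (\<lambda>H. real (card H)) =
      subset_expect S p (\<lambda>H. \<Sum>h\<in>S. of_bool ({h} \<subseteq> H))"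
    unfolding subset_expect_def using assms
    by (intro sum.cong) (auto simp: Int_absorb1 Int_def[symmetric] Collect_conj_eq[symmetric])
  also have "\<dots> = (\<Sum>h\<in>S. p)"
    unfolding subset_expect_sum using assms
    by (intro sum.cong) (auto simp: subset_expect_superset[where G = "{_}", simplified])
  finally show ?thesis by simp
qed

lemma expectation_random_hypergraph:
  assumes "0 \<le> p" "p \<le> 1"
  shows "measure_pmf.expectation (random_hypergraph n d p) f = subset_expect (nsets {1..n} d) p f"
proof -
  define S where "S = nsets {1..n} d"
  have fin: "finite S" by (simp add: S_def finite_imp_finite_nsets)
  define M where "M = Pi_pmf S False (\<lambda>_. bernoulli_pmf p)"
  have supp: "set_pmf M \<subseteq> (\<lambda>H h. h \<in> H) ` Pow S"
  proof
    fix \<phi> assume "\<phi> \<in> set_pmf M"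
    then have "\<phi> x = False" if "x \<notin> S" for x
      using that set_Pi_pmf_subset[OF fin, of False "\<lambda>_. bernoulli_pmf p"] by (auto simp: M_def)
    then show "\<phi> \<in> (\<lambda>H h. h \<in> H) ` Pow S"
      by (intro image_eqI[of _ _ "{x. \<phi> x}"]) auto
  qed
  have "measure_pmf.expectation (random_hypergraph n d p) f
      = measure_pmf.expectation M (\<lambda>\<phi>. f {h \<in> S. \<phi> h})"
    by (simp add: random_hypergraph_def S_def M_def)
  also have "\<dots> = (\<Sum>\<phi>\<in>(\<lambda>H h. h \<in> H) ` Pow S. f {h \<in> S. \<phi> h} * pmf M \<phi>)"
    using supp fin by (intro integral_measure_pmf_real) auto
  also have "\<dots> = (\<Sum>H\<in>Pow S. f {h \<in> S. h \<in> H} * pmf M (\<lambda>h. h \<in> H))"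
    by (subst sum.reindex) (auto simp: inj_on_def fun_eq_iff)
  also have "\<dots> = subset_expect S p f"
    unfolding subset_expect_def
  proof (rule sum.cong)
    fix H assume H: "H \<in> Pow S"
    then have e: "{h \<in> S. h \<in> H} = H" by auto
    have "pmf M (\<lambda>h. h \<in> H) = (\<Prod>h\<in>S. pmf (bernoulli_pmf p) (h \<in> H))"
      using H fin by (auto simp: M_def pmf_Pi)
    also have "\<dots> = (\<Prod>h\<in>S. if h \<in> H then p else 1 - p)"
      using assms by (intro prod.cong) auto
    also have "\<dots> = subset_prob S p H"
      using H fin by (simp add: prod.If_cases subset_prob_def Int_absorb1 Diff_eq)
    finally show "f {h \<in> S. h \<in> H} * pmf M (\<lambda>h. h \<in> H) = subset_prob S p H * f H"
      by (simp add: e)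
  qed simp
  finally show ?thesis by (simp add: S_def)
qed

lemma loss_W_eq:
  assumes "0 \<le> p" "p \<le> 1"
  shows "loss_W n d p B = subset_expect (nsets {1..n} d) p
    (\<lambda>H. real (card (sym_diff (B (proj_W n H)) H))) / (p * real (n choose d))"
  by (simp add: loss_W_def expectation_random_hypergraph[OF assms])

section \<open>Covering the pairs of a vertex set\<close>

text \<open>No uniformity is imposed on \<open>H\<close>, so that it can be a hypergraph or a family
  of traces on \<open>h\<close>.\<close>

definition pairs_covered :: "nat set \<Rightarrow> hypergraph \<Rightarrow> bool" where
  "pairs_covered h H \<longleftrightarrow> (\<forall>e\<in>nsets h 2. \<exists>g\<in>H. e \<subseteq> g)"

text \<open>Such a hyperedge is determined by its part outside \<open>h\<close>, which has
  \<open>d - card \<tau>\<close> vertices.\<close>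

lemma card_fixed_trace_le:
  assumes "h \<in> nsets {1..n} d" "\<tau> \<subseteq> h"
  shows "card {g \<in> nsets {1..n} d. g \<inter> h = \<tau>} \<le> n ^ (d - card \<tau>)"
proof -
  have fin: "finite h" using assms by (auto simp: nsets_def)
  have "card {g \<in> nsets {1..n} d. g \<inter> h = \<tau>} \<le> card (nsets {1..n} (d - card \<tau>))"
  proof (rule card_inj_on_le[where f = "\<lambda>g. g - h"])
    show "inj_on (\<lambda>g. g - h) {g \<in> nsets {1..n} d. g \<inter> h = \<tau>}"
      by (rule inj_onI) blast
    show "(\<lambda>g. g - h) ` {g \<in> nsets {1..n} d. g \<inter> h = \<tau>} \<subseteq> nsets {1..n} (d - card \<tau>)"
      using fin by (auto simp: nsets_def card_Diff_subset_Int)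
  qed (simp add: finite_imp_finite_nsets)
  also have "\<dots> = n choose (d - card \<tau>)" by simp
  also have "\<dots> \<le> n ^ (d - card \<tau>)"
    by (cases "d - card \<tau> \<le> n") (auto simp: binomial_le_pow binomial_eq_0)
  finally show ?thesis .
qed

text \<open>A union bound over the set \<open>T\<close> of traces on \<open>h\<close> of the hyperedges of \<open>H\<close>: hyperedges with
  distinct traces are distinct, so a choice of one hyperedge for each trace costs \<open>p ^ card T\<close>.\<close>

lemma pairs_covered_prob_le:
  fixes M p :: real
  assumes h: "h \<in> nsets {1..n} d" and p: "0 \<le> p" "p \<le> 1" and M: "0 \<le> M"
    and bound: "\<And>T. T \<subseteq> {\<tau>. \<tau> \<subset> h \<and> 2 \<le> card \<tau>} \<Longrightarrow> pairs_covered h T \<Longrightarrow>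
                  (\<Prod>\<tau>\<in>T. real n ^ (d - card \<tau>) * p) \<le> M"
  shows "subset_expect (nsets {1..n} d) p (\<lambda>H. of_bool (pairs_covered h (H - {h}))) \<le> 2 ^ 2 ^ d * M"
proof -
  define S where "S = nsets {1..n} d"
  \<comment> \<open>A hyperedge other than \<open>h\<close> has the size of \<open>h\<close>, so its
    trace is proper; traces with fewer than two vertices cover no pair.\<close>
  define \<T> where "\<T> = {T. T \<subseteq> {\<tau>. \<tau> \<subset> h \<and> 2 \<le> card \<tau>} \<and> pairs_covered h T}"
  define \<Phi> where "\<Phi> = (\<lambda>T. PiE T (\<lambda>\<tau>. {g \<in> S. g \<inter> h = \<tau>}))"
  have finS: "finite S" by (simp add: S_def finite_imp_finite_nsets)
  have finh: "finite h" and cardh: "card h = d" using h by (auto simp: nsets_def)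
  have sub\<T>: "\<T> \<subseteq> Pow (Pow h)" by (auto simp: \<T>_def)
  then have fin\<T>: "finite \<T>" using finh finite_subset by fastforce
  have finT: "finite T" if "T \<in> \<T>" for T
    using that sub\<T> finh by (meson PowD finite_Pow_iff finite_subset subsetD)
  have fin\<Phi>: "finite (\<Phi> T)" if "T \<in> \<T>" for T
    unfolding \<Phi>_def using finT[OF that] finS by (intro finite_PiE) auto
  have \<Phi>: "inj_on \<phi> T" "\<phi> ` T \<subseteq> S" if "\<phi> \<in> \<Phi> T" for \<phi> T
    using that unfolding \<Phi>_def by (auto intro!: inj_on_inverseI[of _ "\<lambda>g. g \<inter> h"] dest!: PiE_mem)
  have "of_bool (pairs_covered h (H - {h})) \<le> (\<Sum>T\<in>\<T>. \<Sum>\<phi>\<in>\<Phi> T. of_bool (\<phi> ` T \<subseteq> H) :: real)"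
    if H: "H \<subseteq> S" for H
  proof (cases "pairs_covered h (H - {h})")
    case True
    define T where "T = {g \<inter> h | g. g \<in> H - {h} \<and> 2 \<le> card (g \<inter> h)}"
    have "\<tau> \<subset> h" if \<tau>: "\<tau> \<in> T" for \<tau>
    proof -
      obtain g where g: "g \<in> H" "g \<noteq> h" "\<tau> = g \<inter> h" using \<tau> by (auto simp: T_def)
      have "finite g" "card g = d" using g H by (auto simp: S_def nsets_def)
      then have "\<not> h \<subseteq> g" using g cardh by (metis card_subset_eq)
      then show ?thesis using g by auto
    qed
    moreover have "2 \<le> card \<tau>" if "\<tau> \<in> T" for \<tau> using that by (auto simp: T_def)
    moreover have "pairs_covered h T"
      unfolding pairs_covered_def
    proof
      fix e assume e: "e \<in> nsets h 2"
      then obtain g where g: "g \<in> H - {h}" "e \<subseteq> g" using True unfolding pairs_covered_def by blast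
      have "e \<subseteq> g \<inter> h" "card e = 2" using e g by (auto simp: nsets_def)
      then have "2 \<le> card (g \<inter> h)" using finh by (metis card_mono finite_Int)
      then have "g \<inter> h \<in> T" using g unfolding T_def by blast
      then show "\<exists>\<tau>\<in>T. e \<subseteq> \<tau>" using \<open>e \<subseteq> g \<inter> h\<close> by blast
    qed
    ultimately have T: "T \<in> \<T>" by (auto simp: \<T>_def)
    have "\<forall>\<tau>\<in>T. \<exists>g. g \<in> H \<and> g \<inter> h = \<tau>" by (auto simp: T_def)
    then obtain \<psi> where \<psi>: "\<And>\<tau>. \<tau> \<in> T \<Longrightarrow> \<psi> \<tau> \<in> H \<and> \<psi> \<tau> \<inter> h = \<tau>" by metis
    define \<phi> where "\<phi> = restrict \<psi> T"
    have \<phi>: "\<phi> \<in> \<Phi> T" using \<psi> H by (auto simp: \<phi>_def \<Phi>_def)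
    have "of_bool (pairs_covered h (H - {h})) = (of_bool (\<phi> ` T \<subseteq> H) :: real)"
      using True \<psi> by (auto simp: \<phi>_def)
    also have "\<dots> \<le> (\<Sum>\<phi>\<in>\<Phi> T. of_bool (\<phi> ` T \<subseteq> H))"
      using fin\<Phi>[OF T] \<phi> by (intro member_le_sum) auto
    also have "\<dots> \<le> (\<Sum>T\<in>\<T>. \<Sum>\<phi>\<in>\<Phi> T. of_bool (\<phi> ` T \<subseteq> H))"
      using fin\<T> T by (intro member_le_sum[of T]) (auto intro!: sum_nonneg)
    finally show ?thesis .
  qed (auto intro!: sum_nonneg)
  then have "subset_expect S p (\<lambda>H. of_bool (pairs_covered h (H - {h})))
      \<le> subset_expect S p (\<lambda>H. \<Sum>T\<in>\<T>. \<Sum>\<phi>\<in>\<Phi> T. of_bool (\<phi> ` T \<subseteq> H))"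
    using p by (intro subset_expect_mono) auto
  also have "\<dots> = (\<Sum>T\<in>\<T>. \<Sum>\<phi>\<in>\<Phi> T. p ^ card T)"
    unfolding subset_expect_sum using \<Phi>
    by (intro sum.cong refl) (simp add: subset_expect_superset[OF finS] card_image)
  also have "\<dots> \<le> (\<Sum>T\<in>\<T>. M)"
  proof (rule sum_mono)
    fix T assume T: "T \<in> \<T>"
    have "(\<Sum>\<phi>\<in>\<Phi> T. p ^ card T) = (\<Prod>\<tau>\<in>T. real (card {g \<in> S. g \<inter> h = \<tau>}) * p)"
      using finT[OF T] by (simp add: \<Phi>_def card_PiE prod.distrib)
    also have "\<dots> \<le> (\<Prod>\<tau>\<in>T. real n ^ (d - card \<tau>) * p)"
    proof (rule prod_mono)
      fix \<tau> assume "\<tau> \<in> T"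
      then have "\<tau> \<subseteq> h" using T by (auto simp: \<T>_def)
      then have "real (card {g \<in> S. g \<inter> h = \<tau>}) \<le> real (n ^ (d - card \<tau>))"
        unfolding S_def by (intro of_nat_mono card_fixed_trace_le h)
      then show "0 \<le> real (card {g \<in> S. g \<inter> h = \<tau>}) * p \<and>
          real (card {g \<in> S. g \<inter> h = \<tau>}) * p \<le> real n ^ (d - card \<tau>) * p"
        using p by (auto intro!: mult_right_mono)
    qed
    also have "\<dots> \<le> M" using T by (intro bound) (auto simp: \<T>_def)
    finally show "(\<Sum>\<phi>\<in>\<Phi> T. p ^ card T) \<le> M" .
  qed
  also have "\<dots> = real (card \<T>) * M" by simp
  also have "\<dots> \<le> 2 ^ 2 ^ d * M"
  proof (rule mult_right_mono)
    have "card \<T> \<le> card (Pow (Pow h))" using finh by (intro card_mono sub\<T>) auto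
    also have "\<dots> = 2 ^ 2 ^ d" using finh cardh by (simp add: card_Pow)
    finally have "real (card \<T>) \<le> real (2 ^ 2 ^ d)" by (rule of_nat_mono)
    then show "real (card \<T>) \<le> 2 ^ 2 ^ d" by simp
  qed (fact M)
  finally show ?thesis by (simp add: S_def)
qed

section \<open>The encoding inequality\<close>

text \<open>The product is the mass function of independent geometric variables indexed by
  \<open>E\<close>, and extensional functions are determined on \<open>E\<close>. Truncating at the
  largest value that occurs leaves a finite product of partial geometric sums.\<close>

lemma sum_prod_geometric_le_1:
  fixes x :: real
  assumes x: "0 < x" "x < 1" and F: "finite F" "F \<subseteq> extensional E" and E: "finite E"
  shows "(\<Sum>w\<in>F. \<Prod>e\<in>E. (1 - x) * x ^ w e) \<le> 1"
proof -
  define m where "m = Max (insert 0 ((\<lambda>(w, e). w e) ` (F \<times> E)))"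
  have "w e \<le> m" if "w \<in> F" "e \<in> E" for w e
    unfolding m_def using that F E by (intro Max_ge) force+
  then have sub: "F \<subseteq> PiE E (\<lambda>_. {..m})"
    using F by (auto simp: PiE_def)
  have "(\<Sum>w\<in>F. \<Prod>e\<in>E. (1 - x) * x ^ w e) \<le> (\<Sum>w\<in>PiE E (\<lambda>_. {..m}). \<Prod>e\<in>E. (1 - x) * x ^ w e)"
    using x E by (intro sum_mono2 sub finite_PiE prod_nonneg) auto
  also have "\<dots> = (\<Prod>e\<in>E. \<Sum>k\<le>m. (1 - x) * x ^ k)"
    using E by (intro prod_sum_PiE[of E "\<lambda>_. {..m}" "\<lambda>_ k. (1 - x) * x ^ k", symmetric]) auto
  also have "(\<Sum>k\<le>m. (1 - x) * x ^ k) = 1 - x ^ Suc m"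
    by (simp only: sum_distrib_left[symmetric] sum_gp_basic)
  also have "(\<Prod>e\<in>E. 1 - x ^ Suc m) \<le> (\<Prod>e\<in>E. 1)"
    using x by (intro prod_mono) (auto simp del: power_Suc simp: power_le_one)
  finally show ?thesis by simp
qed

text \<open>Gibbs' inequality, from \<open>ln y \<le> y - 1\<close> at
  \<open>y = Q x / P x\<close>.\<close>

lemma sum_mult_ln_ratio_nonpos:
  fixes P Q :: "'a \<Rightarrow> real"
  assumes "\<And>x. x \<in> A \<Longrightarrow> P x > 0" "\<And>x. x \<in> A \<Longrightarrow> Q x > 0" "sum Q A \<le> sum P A"
  shows "(\<Sum>x\<in>A. P x * (ln (Q x) - ln (P x))) \<le> 0"
proof -
  have "(\<Sum>x\<in>A. P x * (ln (Q x) - ln (P x))) \<le> (\<Sum>x\<in>A. Q x - P x)"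
  proof (rule sum_mono)
    fix x assume "x \<in> A"
    then have pos: "P x > 0" "Q x > 0" using assms by auto
    then have "P x * (ln (Q x) - ln (P x)) = P x * ln (Q x / P x)" by (simp add: ln_div)
    also have "\<dots> \<le> P x * (Q x / P x - 1)"
      using pos by (intro mult_left_mono ln_le_minus_one) auto
    also have "\<dots> = Q x - P x" using pos by (simp add: field_simps)
    finally show "P x * (ln (Q x) - ln (P x)) \<le> Q x - P x" .
  qed
  then show ?thesis using assms(3) by (simp add: sum_subtractf)
qed

lemma pairs_covered_iff_proj_W:
  assumes h: "h \<in> nsets {1..n} d" and H: "H \<subseteq> nsets {1..n} d"
  shows "pairs_covered h H \<longleftrightarrow> (\<forall>e\<in>nsets h 2. 0 < proj_W n H e)"
proof -
  have "finite H" using H by (rule finite_subset) (simp add: finite_imp_finite_nsets)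
  moreover have "nsets h 2 \<subseteq> nsets {1..n} 2" using h by (auto simp: nsets_def)
  ultimately show ?thesis
    unfolding pairs_covered_def proj_W_def
    by (intro ball_cong refl) (auto simp: card_gt_0_iff)
qed

text \<open>Double counting of incidences between pairs and hyperedges. Hence the cost of the
  weights in the geometric code depends on \<open>H\<close> only through
  \<open>card H\<close>.\<close>

lemma sum_proj_W:
  assumes "H \<subseteq> nsets {1..n} d"
  shows "(\<Sum>e\<in>nsets {1..n} 2. proj_W n H e) = (d choose 2) * card H"
proof -
  have fin: "finite H" using assms by (rule finite_subset) (simp add: finite_imp_finite_nsets)
  have "(\<Sum>e\<in>nsets {1..n} 2. proj_W n H e) = (\<Sum>e\<in>nsets {1..n} 2. \<Sum>h\<in>H. of_bool (e \<subseteq> h))"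
    using fin by (intro sum.cong) (auto simp: proj_W_def Int_def)
  also have "\<dots> = (\<Sum>h\<in>H. \<Sum>e\<in>nsets {1..n} 2. of_bool (e \<subseteq> h))" by (rule sum.swap)
  also have "\<dots> = (\<Sum>h\<in>H. d choose 2)"
  proof (rule sum.cong)
    fix h assume "h \<in> H"
    then have h: "h \<subseteq> {1..n}" "card h = d" using assms by (auto simp: nsets_def)
    have "(\<Sum>e\<in>nsets {1..n} 2. of_bool (e \<subseteq> h)) = card (nsets {1..n} 2 \<inter> {e. e \<subseteq> h})"
      by (simp add: finite_imp_finite_nsets)
    also have "nsets {1..n} 2 \<inter> {e. e \<subseteq> h} = nsets h 2" using h by (auto simp: nsets_def)
    finally show "(\<Sum>e\<in>nsets {1..n} 2. of_bool (e \<subseteq> h)) = d choose 2" using h by simp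
  qed simp
  finally show ?thesis by simp
qed

text \<open>The left side is the entropy without the nonnegative contribution of absent hyperedges.
  On the right, two terms pay for the weights, the third charges \<open>ln 2\<close> per member of
  the output of \<open>B\<close>, the fourth \<open>- ln t\<close> per missed hyperedge, and the
  last bounds the cost of declaring covered \<open>d\<close>-sets outside the output absent.\<close>

lemma encoding_bound:
  fixes p x t :: real
  assumes p: "0 < p" "p < 1" and x: "0 < x" "x < 1" and t: "0 < t" "t \<le> 1/2"
    and B: "\<And>H. H \<subseteq> nsets {1..n} d \<Longrightarrow> B (proj_W n H) \<subseteq> nsets {1..n} d"
  defines "S \<equiv> nsets {1..n} d"
  shows "real (n choose d) * p * - ln p \<le> real (n choose 2) * - ln (1 - x)
    + real (d choose 2) * (real (n choose d) * p) * - ln x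
    + ln 2 * subset_expect S p (\<lambda>H. real (card (B (proj_W n H))))
    + - ln t * subset_expect S p (\<lambda>H. real (card (H - B (proj_W n H))))
    + 2 * t * (\<Sum>h\<in>S. subset_expect S p (\<lambda>H. of_bool (pairs_covered h H)))"
proof -
  define E where "E = nsets {1..n} 2"
  define W where "W = proj_W n"
  define clique where "clique = (\<lambda>(w :: weighted_graph) h. \<forall>e\<in>nsets h 2. 0 < w e)"
  define q where "q = (\<lambda>w :: weighted_graph. \<Prod>e\<in>E. (1 - x) * x ^ w e)"
  \<comment> \<open>Given weights \<open>w\<close>, the code declares \<open>h\<close> present with
    probability \<open>r1 w h\<close> and absent with probability \<open>r0 w h\<close>. Then
    \<open>R w\<close> is a distribution on hypergraphs, which \<open>Q\<close> evaluates at the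
    true projection.\<close>
  define r1 where "r1 = (\<lambda>w h. if h \<in> B w then 1/2 else if clique w h then t else 0)"
  define r0 where "r0 = (\<lambda>w h. if h \<in> B w then 1/2 else if clique w h then 1 - t else 1)"
  define R where "R = (\<lambda>w H. (\<Prod>h\<in>H. r1 w h) * (\<Prod>h\<in>S - H. r0 w h))"
  define Q where "Q = (\<lambda>H. q (W H) * R (W H) H)"
  have finS: "finite S" and finE: "finite E"
    by (simp_all add: S_def E_def finite_imp_finite_nsets)
  have cardS: "card S = n choose d" and cardE: "card E = n choose 2"
    by (simp_all add: S_def E_def)
  have r1_nonneg: "0 \<le> r1 w h" and r0_pos: "0 < r0 w h" for w h
    using t by (auto simp: r1_def r0_def)
  have r_sum: "r1 w h + r0 w h = 1" for w h by (auto simp: r1_def r0_def)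
  have q_pos: "0 < q w" for w using x by (auto simp: q_def intro!: prod_pos)
  have R_sum: "(\<Sum>H\<in>Pow S. R w H) = 1" for w
    using prod_add[OF finS, of "r1 w" "r0 w"] by (simp add: R_def r_sum)
  have R_nonneg: "0 \<le> R w H" for w H
    unfolding R_def using r1_nonneg less_imp_le[OF r0_pos]
    by (intro mult_nonneg_nonneg prod_nonneg) auto

  \<comment> \<open>Summing over all possible \<open>w\<close> instead of the true projection
    decouples \<open>w\<close> from \<open>H\<close>: \<open>R w\<close> sums to 1 over
    \<open>H\<close>, and \<open>q\<close> to at most 1.\<close>
  have "sum Q (Pow S) \<le> (\<Sum>H\<in>Pow S. \<Sum>w\<in>W ` Pow S. q w * R w H)"
  proof (rule sum_mono)
    fix H assume "H \<in> Pow S"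
    then show "Q H \<le> (\<Sum>w\<in>W ` Pow S. q w * R w H)"
      unfolding Q_def using finS less_imp_le[OF q_pos] R_nonneg
      by (intro member_le_sum[where f = "\<lambda>w. q w * R w H"]) auto
  qed
  also have "\<dots> = (\<Sum>w\<in>W ` Pow S. q w)"
    by (subst sum.swap) (simp add: sum_distrib_left[symmetric] R_sum)
  also have "\<dots> \<le> 1"
    unfolding q_def using finS finE x
    by (intro sum_prod_geometric_le_1) (auto simp: W_def E_def proj_W_def)
  also have "\<dots> = sum (subset_prob S p) (Pow S)"
    using subset_expect_const[OF finS, of p 1] by (simp add: subset_expect_def)
  finally have Q_sum: "sum Q (Pow S) \<le> sum (subset_prob S p) (Pow S)" .

  have clique: "clique (W H) h \<longleftrightarrow> pairs_covered h H" if "H \<subseteq> S" "h \<in> S" for H h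
    using that by (simp add: clique_def W_def S_def pairs_covered_iff_proj_W)
  \<comment> \<open>A hyperedge covers its own pairs, so the value 0 of \<open>r1\<close> is never
    met on \<open>H\<close> and the code length is finite.\<close>
  have r1_pos: "0 < r1 (W H) h" if "H \<subseteq> S" "h \<in> H" for H h
  proof -
    have "pairs_covered h H" using that by (auto simp: pairs_covered_def nsets_def)
    then show ?thesis using clique[OF that(1)] that t by (auto simp: r1_def)
  qed
  have Q_pos: "0 < Q H" if "H \<in> Pow S" for H
    using that q_pos r0_pos r1_pos by (auto simp: Q_def R_def intro!: mult_pos_pos prod_pos)
  have P_pos: "0 < subset_prob S p H" for H using p by (simp add: subset_prob_def)

  define f where "f = (\<lambda>H. real (card E) * - ln (1 - x) + real ((d choose 2) * card H) * - ln x
     + ln 2 * real (card (B (W H))) + - ln t * real (card (H - B (W H)))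
     + 2 * t * (\<Sum>h\<in>S. of_bool (pairs_covered h H)))"
  have ln_Q: "- ln (Q H) \<le> f H" if H: "H \<subseteq> S" for H
  proof -
    define w where "w = W H"
    have finH: "finite H" using H finS by (rule finite_subset)
    have Bw: "B w \<subseteq> S" using B H by (simp add: w_def W_def S_def)
    have "ln (q w) = (\<Sum>e\<in>E. ln ((1 - x) * x ^ w e))"
      unfolding q_def using x finE by (intro ln_prod) auto
    also have "\<dots> = (\<Sum>e\<in>E. ln (1 - x) + real (w e) * ln x)"
      using x by (intro sum.cong) (auto simp: ln_mult ln_realpow)
    also have "\<dots> = real (card E) * ln (1 - x) + real (\<Sum>e\<in>E. w e) * ln x"
      by (simp add: sum.distrib sum_distrib_right)
    also have "(\<Sum>e\<in>E. w e) = (d choose 2) * card H"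
      using sum_proj_W H by (simp add: E_def w_def W_def S_def)
    finally have ln_q: "- ln (q w) = real (card E) * - ln (1 - x) + real ((d choose 2) * card H) * - ln x"
      by simp
    have "- ln (\<Prod>h\<in>H. r1 w h) = (\<Sum>h\<in>H. - ln (r1 w h))"
      using r1_pos[OF H, THEN less_imp_neq] finH by (subst ln_prod) (auto simp: w_def sum_negf)
    also have "\<dots> = (\<Sum>h\<in>H. if h \<in> B w then ln 2 else - ln t)"
    proof (rule sum.cong)
      fix h assume "h \<in> H"
      then show "- ln (r1 w h) = (if h \<in> B w then ln 2 else - ln t)"
        using r1_pos[OF H, of h] by (auto simp: r1_def w_def ln_div split: if_splits)
    qed simp
    also have "\<dots> = ln 2 * real (card (H \<inter> B w)) + - ln t * real (card (H - B w))"
      using finH by (simp add: sum.If_cases Diff_eq)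
    finally have ln1: "- ln (\<Prod>h\<in>H. r1 w h) = ln 2 * real (card (H \<inter> B w)) + - ln t * real (card (H - B w))" .
    have "- ln (\<Prod>h\<in>S - H. r0 w h) = (\<Sum>h\<in>S - H. - ln (r0 w h))"
      using less_imp_neq[OF r0_pos] finS by (subst ln_prod) (auto simp: sum_negf)
    also have "\<dots> \<le> (\<Sum>h\<in>S - H. of_bool (h \<in> B w) * ln 2 + 2 * t * of_bool (pairs_covered h H))"
    proof (rule sum_mono)
      fix h assume "h \<in> S - H"
      then have cl: "clique w h \<longleftrightarrow> pairs_covered h H" using clique[OF H] by (simp add: w_def)
      \<comment> \<open>The bound \<open>ln y \<le> y - 1\<close> at \<open>y = 1 / (1 - t)\<close>;
        the hypothesis \<open>t \<le> 1/2\<close> then allows the replacement by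
        \<open>2 * t\<close>.\<close>
      have "- ln (1 - t) \<le> t / (1 - t)"
        using ln_le_minus_one[of "1 / (1 - t)"] t by (simp add: ln_div field_simps)
      also have "\<dots> \<le> 2 * t" using t by (simp add: field_simps)
      finally show "- ln (r0 w h) \<le> of_bool (h \<in> B w) * ln 2 + 2 * t * of_bool (pairs_covered h H)"
        using cl t by (auto simp: r0_def ln_div)
    qed
    also have "\<dots> = ln 2 * real (card (B w - H)) + 2 * t * (\<Sum>h\<in>S - H. of_bool (pairs_covered h H))"
    proof -
      have "(S - H) \<inter> {h. h \<in> B w} = B w - H" using Bw by auto
      then have "(\<Sum>h\<in>S - H. of_bool (h \<in> B w)) = real (card (B w - H))"
        using finS by (simp only: sum_of_bool_eq finite_Diff)
      then show ?thesis
        unfolding sum.distrib sum_distrib_left[symmetric] sum_distrib_right[symmetric] by simp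
    qed
    also have "\<dots> \<le> ln 2 * real (card (B w - H)) + 2 * t * (\<Sum>h\<in>S. of_bool (pairs_covered h H))"
      using t finS by (intro add_left_mono mult_left_mono sum_mono2) auto
    finally have ln0: "- ln (\<Prod>h\<in>S - H. r0 w h) \<le>
      ln 2 * real (card (B w - H)) + 2 * t * (\<Sum>h\<in>S. of_bool (pairs_covered h H))" .
    have "card (B w) = card (H \<inter> B w) + card (B w - H)"
      using card_Int_Diff[of "B w" H] finite_subset[OF Bw finS] by (simp add: Int_commute)
    then have cB: "ln 2 * real (card (B w)) = ln 2 * real (card (H \<inter> B w)) + ln 2 * real (card (B w - H))"
      by (simp add: algebra_simps)
    have "0 < (\<Prod>h\<in>H. r1 w h)" "0 < (\<Prod>h\<in>S - H. r0 w h)"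
      using r1_pos[OF H] r0_pos by (auto simp: w_def intro!: prod_pos)
    then have "ln (Q H) = ln (q w) + (ln (\<Prod>h\<in>H. r1 w h) + ln (\<Prod>h\<in>S - H. r0 w h))"
      using q_pos[of w] by (simp add: Q_def R_def w_def[symmetric] ln_mult)
    then show ?thesis
      using ln_q ln1 ln0 cB unfolding f_def w_def[symmetric] by linarith
  qed
  have ln_P: "real (card H) * - ln p \<le> - ln (subset_prob S p H)" for H
    using p by (simp add: subset_prob_def ln_mult ln_realpow mult_nonneg_nonpos)

  \<comment> \<open>By \<open>ln_Q\<close> the sum \<open>f H + ln (Q H)\<close> is nonnegative and
    may be added; the remaining logarithmic ratio has nonpositive expectation by Gibbs'
    inequality.\<close>
  have "subset_expect S p (\<lambda>H. real (card H) * - ln p) \<le>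
      subset_expect S p (\<lambda>H. f H + (ln (Q H) - ln (subset_prob S p H)))"
  proof (rule subset_expect_mono)
    fix H assume "H \<subseteq> S"
    from ln_Q[OF this] ln_P[of H]
    show "real (card H) * - ln p \<le> f H + (ln (Q H) - ln (subset_prob S p H))" by linarith
  qed (use p in auto)
  also have "\<dots> = subset_expect S p f + subset_expect S p (\<lambda>H. ln (Q H) - ln (subset_prob S p H))"
    by (rule subset_expect_add)
  also have "subset_expect S p (\<lambda>H. ln (Q H) - ln (subset_prob S p H)) \<le> 0"
    unfolding subset_expect_def using Q_pos P_pos Q_sum by (intro sum_mult_ln_ratio_nonpos) auto
  finally have "subset_expect S p (\<lambda>H. real (card H) * - ln p) \<le> subset_expect S p f" by simp
  moreover have "subset_expect S p (\<lambda>H. real (card H) * - ln p) = real (n choose d) * p * - ln p"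
    using subset_expect_cmult[of S p "- ln p" "\<lambda>H. real (card H)"]
    by (simp add: subset_expect_card[OF finS] cardS mult_ac)
  moreover have "subset_expect S p f = real (n choose 2) * - ln (1 - x)
    + real (d choose 2) * (real (n choose d) * p) * - ln x
    + ln 2 * subset_expect S p (\<lambda>H. real (card (B (W H))))
    + - ln t * subset_expect S p (\<lambda>H. real (card (H - B (W H))))
    + 2 * t * (\<Sum>h\<in>S. subset_expect S p (\<lambda>H. of_bool (pairs_covered h H)))"
  proof -
    have "subset_expect S p (\<lambda>H. real ((d choose 2) * card H) * - ln x)
       = real (d choose 2) * (real (n choose d) * p) * - ln x"
      using subset_expect_cmult[of S p "real (d choose 2) * - ln x" "\<lambda>H. real (card H)"]
      by (simp add: subset_expect_card[OF finS] cardS mult_ac)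
    then show ?thesis
      unfolding f_def subset_expect_add subset_expect_const[OF finS] subset_expect_cmult
        subset_expect_sum cardE by simp
  qed
  ultimately show ?thesis by (simp add: W_def)
qed

section \<open>Costs of traces\<close>

lemma pairs_covered_choose_le:
  assumes "finite T" "\<And>\<tau>. \<tau> \<in> T \<Longrightarrow> finite \<tau>" "pairs_covered h T"
  shows "card h choose 2 \<le> (\<Sum>\<tau>\<in>T. card \<tau> choose 2)"
proof -
  have "nsets h 2 \<subseteq> (\<Union>\<tau>\<in>T. nsets \<tau> 2)"
    using assms(3) by (fastforce simp: pairs_covered_def nsets_def)
  then have "card (nsets h 2) \<le> card (\<Union>\<tau>\<in>T. nsets \<tau> 2)"
    using assms by (intro card_mono finite_UN_I) (auto simp: finite_imp_finite_nsets)
  also have "\<dots> \<le> (\<Sum>\<tau>\<in>T. card (nsets \<tau> 2))" using assms by (intro card_UN_le)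
  finally show ?thesis by simp
qed

text \<open>A single proper subset misses a vertex of \<open>h\<close> and every pair through it.
  The second trace provides the gain in \<open>sum_trace_cost_ge_subcritical\<close>.\<close>

lemma two_le_card_if_pairs_covered:
  assumes h: "finite h" "2 \<le> card h" and T: "finite T" "\<And>\<tau>. \<tau> \<in> T \<Longrightarrow> \<tau> \<subset> h"
    and cov: "pairs_covered h T"
  shows "2 \<le> card T"
proof (rule ccontr)
  assume "\<not> 2 \<le> card T"
  then consider "T = {}" | \<tau> where "T = {\<tau>}"
    using T(1) by (metis One_nat_def card_0_eq card_1_singletonE less_2_cases not_le_imp_less)
  then obtain \<tau> where \<tau>: "\<tau> \<subset> h" "\<And>e. e \<in> nsets h 2 \<Longrightarrow> e \<subseteq> \<tau>"
  proof cases
    case 1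
    have "card (nsets h 2) > 0" using h by simp
    then have "nsets h 2 \<noteq> {}" by force
    then show ?thesis using cov 1 by (auto simp: pairs_covered_def)
  next
    case (2 \<sigma>)
    then show ?thesis using cov T that[of \<sigma>] by (auto simp: pairs_covered_def)
  qed
  then obtain x where x: "x \<in> h" "x \<notin> \<tau>" by blast
  have "h \<noteq> {x}" using h by auto
  then obtain y where "y \<in> h" "y \<noteq> x" using x by blast
  then have "{x, y} \<in> nsets h 2" using x by (auto simp: nsets_def)
  then show False using \<tau> x by blast
qed

lemma real_choose_2: "real (k choose 2) = real k * (real k - 1) / 2"
  by (induction k) (auto simp: numeral_2_eq_2 field_simps)

text \<open>The difference of the two sides is \<open>(k - 2) * (1 - (1 - \<delta>) * (k + 1) / 2)\<close>, and the second factor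
  vanishes for \<open>k = d\<close> at the critical \<open>\<delta>\<close>.\<close>

lemma choose_2_mult_le:
  fixes \<delta> :: real
  assumes "(real d - 1) / (real d + 1) \<le> \<delta>" "\<delta> \<le> 1" "2 \<le> k" "k \<le> d"
  shows "real (k choose 2) * (1 - \<delta>) \<le> real k - 1 - \<delta>"
proof -
  have "(1 - \<delta>) * (real k + 1) \<le> (1 - \<delta>) * (real d + 1)"
    using assms by (intro mult_left_mono) auto
  also have "\<dots> \<le> 2" using assms by (simp add: field_simps)
  finally have "0 \<le> (real k - 2) * (1 - (1 - \<delta>) * (real k + 1) / 2)"
    using assms by (intro mult_nonneg_nonneg) auto
  then show ?thesis by (simp add: real_choose_2 field_simps)
qed

text \<open>The factorisation behind \<open>choose_2_mult_le\<close> at \<open>k = d\<close>, now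
  with both factors positive. It makes \<gamma> positive when
  \<open>\<delta> \<le> 1\<close>.\<close>

lemma choose_2_mult_less:
  fixes \<delta> :: real
  assumes "(real d - 1) / (real d + 1) < \<delta>" "3 \<le> d"
  shows "real (d choose 2) * (1 - \<delta>) < real d - 1 - \<delta>"
proof -
  have "(1 - \<delta>) * (real d + 1) < 2" using assms by (simp add: field_simps)
  then have "0 < (real d - 2) * (1 - (1 - \<delta>) * (real d + 1) / 2)"
    using assms by (intro mult_pos_pos) auto
  then show ?thesis by (simp add: real_choose_2 field_simps)
qed

text \<open>Each trace costs at least \<open>1 - \<delta>\<close> per pair that it contains, and
  together the traces contain all pairs of \<open>h\<close>.\<close>

lemma sum_trace_cost_ge:
  fixes \<delta> :: real
  assumes "(real d - 1) / (real d + 1) \<le> \<delta>" "\<delta> \<le> 1" "finite h" "card h = d"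
    and T: "T \<subseteq> {\<tau>. \<tau> \<subset> h \<and> 2 \<le> card \<tau>}" "pairs_covered h T"
  shows "real (d choose 2) * (1 - \<delta>) \<le> (\<Sum>\<tau>\<in>T. real (card \<tau>) - 1 - \<delta>)"
proof -
  have "T \<subseteq> Pow h" using T by auto
  then have finT: "finite T" using assms by (meson finite_Pow_iff finite_subset)
  have fin: "finite \<tau>" if "\<tau> \<in> T" for \<tau>
    using T that assms finite_subset[of \<tau> h] by auto
  have "real (d choose 2) * (1 - \<delta>) \<le> real (\<Sum>\<tau>\<in>T. card \<tau> choose 2) * (1 - \<delta>)"
    using pairs_covered_choose_le[OF finT fin T(2)] assms by (intro mult_right_mono of_nat_mono) auto
  also have "\<dots> = (\<Sum>\<tau>\<in>T. real (card \<tau> choose 2) * (1 - \<delta>))"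
    by (simp add: sum_distrib_right)
  also have "\<dots> \<le> (\<Sum>\<tau>\<in>T. real (card \<tau>) - 1 - \<delta>)"
  proof (rule sum_mono)
    fix \<tau> assume "\<tau> \<in> T"
    then have "\<tau> \<subseteq> h" "2 \<le> card \<tau>" using T by auto
    moreover from this have "card \<tau> \<le> d" using assms card_mono by blast
    ultimately show "real (card \<tau> choose 2) * (1 - \<delta>) \<le> real (card \<tau>) - 1 - \<delta>"
      using assms by (intro choose_2_mult_le) auto
  qed
  finally show ?thesis .
qed

text \<open>At the critical value \<open>s\<close> the cost of \<open>h\<close> is
  \<open>(d choose 2) * (1 - s)\<close>, so the traces cost at least as much. Passing from
  \<open>s\<close> to \<delta> adds \<open>s - \<delta>\<close> to the cost of \<open>h\<close> and
  to that of each trace, and there are at least two traces.\<close>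

lemma sum_trace_cost_ge_subcritical:
  fixes \<delta> :: real
  assumes "\<delta> \<le> (real d - 1) / (real d + 1)" "3 \<le> d" "finite h" "card h = d"
    and T: "T \<subseteq> {\<tau>. \<tau> \<subset> h \<and> 2 \<le> card \<tau>}" "pairs_covered h T"
  shows "real d - 1 - \<delta> + ((real d - 1) / (real d + 1) - \<delta>) \<le> (\<Sum>\<tau>\<in>T. real (card \<tau>) - 1 - \<delta>)"
proof -
  define s where "s = (real d - 1) / (real d + 1)"
  have "T \<subseteq> Pow h" using T by auto
  then have finT: "finite T" using assms by (meson finite_Pow_iff finite_subset)
  have "2 \<le> card T"
    using assms finT by (intro two_le_card_if_pairs_covered[of h T]) auto
  then have "2 * (s - \<delta>) \<le> real (card T) * (s - \<delta>)"
    using assms by (intro mult_right_mono) (auto simp: s_def)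
  moreover have "real (d choose 2) * (1 - s) \<le> (\<Sum>\<tau>\<in>T. real (card \<tau>) - 1 - s)"
    using assms by (intro sum_trace_cost_ge[of _ _ h]) (auto simp: s_def field_simps)
  moreover have "(\<Sum>\<tau>\<in>T. real (card \<tau>) - 1 - \<delta>) =
      (\<Sum>\<tau>\<in>T. real (card \<tau>) - 1 - s) + real (card T) * (s - \<delta>)"
    by (simp add: sum_subtractf algebra_simps)
  moreover have "real (d choose 2) * (1 - s) = real d - 1 - s"
    by (simp add: real_choose_2 s_def field_simps)
  ultimately have "(real d - 1 - s) + 2 * (s - \<delta>) \<le> (\<Sum>\<tau>\<in>T. real (card \<tau>) - 1 - \<delta>)"
    by (metis add_mono)
  then show ?thesis unfolding s_def[symmetric] by (simp add: algebra_simps)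
qed

text \<open>The exponents of the factors add up to the total trace cost; \<open>1 \<le> C\<close>
  and \<open>card T \<le> 2 ^ d\<close> make the constant independent of \<open>T\<close>.\<close>

lemma prod_trace_le:
  fixes C p \<delta> x :: real
  assumes n: "1 \<le> n" and C: "1 \<le> C" and p: "0 \<le> p" "p \<le> C * real n powr (- real d + 1 + \<delta>)"
    and h: "finite h" "card h = d" and T: "T \<subseteq> Pow h"
    and x: "x \<le> (\<Sum>\<tau>\<in>T. real (card \<tau>) - 1 - \<delta>)"
  shows "(\<Prod>\<tau>\<in>T. real n ^ (d - card \<tau>) * p) \<le> C ^ 2 ^ d * real n powr - x"
proof -
  have "(\<Prod>\<tau>\<in>T. real n ^ (d - card \<tau>) * p) \<le> (\<Prod>\<tau>\<in>T. C * real n powr - (real (card \<tau>) - 1 - \<delta>))"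
  proof (rule prod_mono)
    fix \<tau> assume "\<tau> \<in> T"
    then have "card \<tau> \<le> d" using T h by (auto intro: card_mono)
    have "real n ^ (d - card \<tau>) * p
        \<le> real n powr (real d - real (card \<tau>)) * (C * real n powr (- real d + 1 + \<delta>))"
      using p n \<open>card \<tau> \<le> d\<close> by (intro mult_mono) (auto simp: powr_realpow[symmetric] of_nat_diff)
    also have "\<dots> = C * real n powr - (real (card \<tau>) - 1 - \<delta>)"
      by (simp add: powr_add[symmetric] algebra_simps)
    finally show "0 \<le> real n ^ (d - card \<tau>) * p \<and>
        real n ^ (d - card \<tau>) * p \<le> C * real n powr - (real (card \<tau>) - 1 - \<delta>)"
      using p by auto
  qed
  also have "\<dots> = C ^ card T * real n powr - (\<Sum>\<tau>\<in>T. real (card \<tau>) - 1 - \<delta>)"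
    using n by (simp add: prod.distrib powr_sum sum_negf[symmetric])
  also have "\<dots> \<le> C ^ 2 ^ d * real n powr - x"
  proof (intro mult_mono power_increasing powr_mono)
    show "card T \<le> 2 ^ d" using card_mono[OF _ T] h by (simp add: card_Pow)
  qed (use n C x in auto)
  finally show ?thesis .
qed

section \<open>Bounds on the partial recovery loss\<close>

lemma partial_recovery_loss_W_nonneg:
  assumes "0 \<le> p" "p \<le> 1"
  shows "0 \<le> partial_recovery_loss_W n d p"
proof -
  have "0 \<le> loss_W n d p B" for B
    using assms by (auto simp: loss_W_def intro!: divide_nonneg_nonneg integral_nonneg_AE)
  then show ?thesis
    using finite_estimators_W estimators_W_nonempty by (auto simp: partial_recovery_loss_W_def)
qed

text \<open>The estimator with empty output errs exactly on the hyperedges, of which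
  \<open>p * real (n choose d)\<close> are expected.\<close>

lemma partial_recovery_loss_W_le_1:
  assumes "0 < p" "p \<le> 1"
  shows "partial_recovery_loss_W n d p \<le> 1"
proof -
  define B where "B = (\<lambda>w\<in>weighted_projections n d. {} :: hypergraph)"
  have "B \<in> estimators_W n d" by (auto simp: B_def estimators_W_def)
  then have "partial_recovery_loss_W n d p \<le> loss_W n d p B"
    unfolding partial_recovery_loss_W_def by (intro Min_le) (auto simp: finite_estimators_W)
  also have "loss_W n d p B =
      subset_expect (nsets {1..n} d) p (\<lambda>H. real (card H)) / (p * real (n choose d))"
    using assms unfolding loss_W_eq[OF less_imp_le[OF assms(1)] assms(2)] subset_expect_def
    by (intro arg_cong2[where f = "(/)"] sum.cong) (auto simp: B_def weighted_projections_def)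
  also have "\<dots> \<le> 1"
    using assms by (subst subset_expect_card) (auto simp: finite_imp_finite_nsets)
  finally show ?thesis .
qed

section \<open>Upper bound on the loss below the threshold\<close>

lemma partial_recovery_loss_W_le_pairs_covered:
  assumes "0 < p" "p \<le> 1"
  shows "partial_recovery_loss_W n d p \<le>
    (\<Sum>h\<in>nsets {1..n} d. subset_expect (nsets {1..n} d) p (\<lambda>H. of_bool (pairs_covered h (H - {h}))))
      / (p * real (n choose d))"
proof -
  define S where "S = nsets {1..n} d"
  have finS: "finite S" by (simp add: S_def finite_imp_finite_nsets)
  define B where "B = (\<lambda>w\<in>weighted_projections n d. {h \<in> S. \<forall>e\<in>nsets h 2. 0 < w e})"
  have "B \<in> estimators_W n d" by (auto simp: B_def estimators_W_def S_def)
  then have "partial_recovery_loss_W n d p \<le> loss_W n d p B"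
    unfolding partial_recovery_loss_W_def by (intro Min_le) (auto simp: finite_estimators_W)
  also have "\<dots> \<le> (\<Sum>h\<in>S. subset_expect S p (\<lambda>H. of_bool (pairs_covered h (H - {h}))))
      / (p * real (n choose d))"
    unfolding loss_W_eq[OF less_imp_le[OF assms(1)] assms(2)] S_def[symmetric]
      subset_expect_sum[symmetric]
  proof (intro divide_right_mono subset_expect_mono)
    fix H assume H: "H \<subseteq> S"
    have B: "B (proj_W n H) = {h \<in> S. pairs_covered h H}"
      using H pairs_covered_iff_proj_W[of _ n d H]
      by (auto simp: B_def weighted_projections_def S_def)
    have "H \<subseteq> B (proj_W n H)"
      unfolding B using H by (auto simp: pairs_covered_def nsets_def)
    \<comment> \<open>No hyperedge is missed, so every error is an absent \<open>h\<close>, for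
      which \<open>H - {h}\<close> equals \<open>H\<close>. Removing \<open>h\<close> keeps
      hyperedges from being counted as covered by themselves.\<close>
    then have "sym_diff (B (proj_W n H)) H = S \<inter> {h. h \<notin> H \<and> pairs_covered h H}"
      using B by auto
    also have "card \<dots> \<le> card (S \<inter> {h. pairs_covered h (H - {h})})"
      using finS by (intro card_mono) auto
    finally show "real (card (sym_diff (B (proj_W n H)) H)) \<le> (\<Sum>h\<in>S. of_bool (pairs_covered h (H - {h})))"
      using finS by simp
  qed (use assms in auto)
  finally show ?thesis by (simp add: S_def)
qed

text \<open>A \<open>d\<close>-set is falsely output with probability of order at most
  \<open>n powr - (d - 1 - \<delta> + \<eta>)\<close>, where \<eta> is the distance to the
  threshold; dividing by \<open>p\<close> leaves \<open>n powr - \<eta>\<close>.\<close>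

lemma partial_recovery_loss_W_le_powr:
  fixes \<delta> C cl p :: real
  assumes d: "3 \<le> d" "d \<le> n" and \<delta>: "\<delta> \<le> (real d - 1) / (real d + 1)"
    and C: "1 \<le> C" and cl: "0 < cl" and p: "0 < p" "p \<le> 1"
    and p_bounds: "cl * real n powr (- real d + 1 + \<delta>) \<le> p" "p \<le> C * real n powr (- real d + 1 + \<delta>)"
  shows "partial_recovery_loss_W n d p \<le>
    2 ^ 2 ^ d * C ^ 2 ^ d / cl * real n powr - ((real d - 1) / (real d + 1) - \<delta>)"
proof -
  define \<eta> where "\<eta> = (real d - 1) / (real d + 1) - \<delta>"
  define M where "M = C ^ 2 ^ d * real n powr - (real d - 1 - \<delta> + \<eta>)"
  have M: "0 \<le> M" using C by (simp add: M_def)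
  have N: "0 < real (n choose d)" using d by simp
  have "subset_expect (nsets {1..n} d) p (\<lambda>H. of_bool (pairs_covered h (H - {h}))) \<le> 2 ^ 2 ^ d * M"
    if h: "h \<in> nsets {1..n} d" for h
  proof (rule pairs_covered_prob_le[OF h])
    fix T assume T: "T \<subseteq> {\<tau>. \<tau> \<subset> h \<and> 2 \<le> card \<tau>}" "pairs_covered h T"
    have "finite h" "card h = d" using h by (auto simp: nsets_def)
    with T d show "(\<Prod>\<tau>\<in>T. real n ^ (d - card \<tau>) * p) \<le> M"
      unfolding M_def \<eta>_def using C p p_bounds \<delta>
      by (intro prod_trace_le[of n C p d \<delta> h] sum_trace_cost_ge_subcritical) auto
  qed (use p M in auto)
  then have "(\<Sum>h\<in>nsets {1..n} d. subset_expect (nsets {1..n} d) p (\<lambda>H. of_bool (pairs_covered h (H - {h}))))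
      \<le> (\<Sum>h\<in>nsets {1..n} d. 2 ^ 2 ^ d * M)" by (rule sum_mono)
  then have "partial_recovery_loss_W n d p \<le> real (n choose d) * (2 ^ 2 ^ d * M) / (p * real (n choose d))"
    using p by (intro order.trans[OF partial_recovery_loss_W_le_pairs_covered] divide_right_mono) auto
  also have "\<dots> = 2 ^ 2 ^ d * M / p" using N by simp
  also have "\<dots> \<le> 2 ^ 2 ^ d * M / (cl * real n powr (- real d + 1 + \<delta>))"
    using p_bounds p M cl d by (intro divide_left_mono mult_pos_pos) auto
  also have "\<dots> = 2 ^ 2 ^ d * C ^ 2 ^ d / cl *
      (real n powr - (real d - 1 - \<delta> + \<eta>) / real n powr (- real d + 1 + \<delta>))"
    by (simp add: M_def)
  also have "real n powr - (real d - 1 - \<delta> + \<eta>) / real n powr (- real d + 1 + \<delta>) = real n powr - \<eta>"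
    using d by (simp add: powr_diff[symmetric])
  finally show ?thesis by (simp add: \<eta>_def)
qed

section \<open>Lower bound on the loss above the threshold\<close>

text \<open>Either \<open>h\<close> is a hyperedge or the others cover it;
  \<open>choose_2_mult_less\<close> and \<open>sum_trace_cost_ge\<close> bound the two cases. For
  \<open>\<delta> > 1\<close> the exponent is 0 and the bound trivial.\<close>

lemma pairs_covered_prob_le_powr:
  fixes \<delta> C p :: real
  assumes d: "3 \<le> d" "1 \<le> n" and \<delta>: "(real d - 1) / (real d + 1) < \<delta>"
    and C: "1 \<le> C" and p: "0 \<le> p" "p \<le> 1" "p \<le> C * real n powr (- real d + 1 + \<delta>)"
    and h: "h \<in> nsets {1..n} d"
  shows "subset_expect (nsets {1..n} d) p (\<lambda>H. of_bool (pairs_covered h H)) \<le>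
    (C + 2 ^ 2 ^ d * C ^ 2 ^ d) * real n powr - (real (d choose 2) * max (1 - \<delta>) 0)"
    (is "?E \<le> (C + ?A) * _")
proof -
  define S where "S = nsets {1..n} d"
  have finS: "finite S" by (simp add: S_def finite_imp_finite_nsets)
  have A: "1 \<le> C + ?A" using C by (simp add: add_increasing2)
  show ?thesis
  proof (cases "\<delta> \<le> 1")
    case False
    have "?E \<le> subset_expect S p (\<lambda>_. 1)"
      unfolding S_def using p by (intro subset_expect_mono) auto
    then show ?thesis using False A finS d by (simp add: subset_expect_const max_def)
  next
    case True
    define M where "M = C ^ 2 ^ d * real n powr - (real (d choose 2) * (1 - \<delta>))"
    have "?E \<le> subset_expect S p (\<lambda>H. of_bool ({h} \<subseteq> H) + of_bool (pairs_covered h (H - {h})))"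
      unfolding S_def
    proof (rule subset_expect_mono)
      fix H
      have "H - {h} = H" if "h \<notin> H" using that by simp
      then show "of_bool (pairs_covered h H) \<le>
          (of_bool ({h} \<subseteq> H) + of_bool (pairs_covered h (H - {h})) :: real)"
        by (cases "h \<in> H") auto
    qed (use p in auto)
    also have "\<dots> = p ^ card {h} + subset_expect S p (\<lambda>H. of_bool (pairs_covered h (H - {h})))"
      using subset_expect_superset[OF finS, of "{h}" p] h by (simp add: subset_expect_add S_def)
    also have "subset_expect S p (\<lambda>H. of_bool (pairs_covered h (H - {h}))) \<le> 2 ^ 2 ^ d * M"
      unfolding S_def
    proof (rule pairs_covered_prob_le[OF h])
      fix T assume T: "T \<subseteq> {\<tau>. \<tau> \<subset> h \<and> 2 \<le> card \<tau>}" "pairs_covered h T"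
      have "finite h" "card h = d" using h by (auto simp: nsets_def)
      with T d True show "(\<Prod>\<tau>\<in>T. real n ^ (d - card \<tau>) * p) \<le> M"
        unfolding M_def using C p \<delta>
        by (intro prod_trace_le[of n C p d \<delta> h] sum_trace_cost_ge[of d \<delta> h]) auto
    qed (use p C in \<open>auto simp: M_def\<close>)
    also have "p ^ card {h} \<le> C * real n powr - (real (d choose 2) * (1 - \<delta>))"
    proof -
      have "real n powr (- real d + 1 + \<delta>) \<le> real n powr - (real (d choose 2) * (1 - \<delta>))"
        using choose_2_mult_less[OF \<delta>] d by (intro powr_mono) auto
      then show ?thesis using p C by (auto intro: order.trans mult_left_mono)
    qed
    finally show ?thesis using True by (simp add: M_def algebra_simps)
  qed
qed

lemma power_le_mult_binomial:
  assumes "1 \<le> d" "d \<le> n"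
  shows "real n ^ d \<le> real d ^ d * real (n choose d)"
  using binomial_ge_n_over_k_pow_k[of d n, where 'a = real] assms
  by (simp add: power_divide field_simps)

text \<open>The leading terms in \<open>encoding_bound\<close> are multiples of
  \<open>m * L\<close>: the entropy has coefficient \<open>d - 1 - \<delta>\<close> and the weights
  take \<open>(d choose 2) * \<kappa>\<close>, leaving \<gamma>. Costs of order \<open>m\<close> are
  collected in \<open>K\<close>.\<close>

lemma loss_W_ge:
  fixes \<delta> C cl p :: real
  assumes d: "3 \<le> d" "d \<le> n" and \<delta>: "(real d - 1) / (real d + 1) < \<delta>"
    and C: "1 \<le> C" and cl: "0 < cl" and p: "0 < p" "p < 1"
    and p_bounds: "cl * real n powr (- real d + 1 + \<delta>) \<le> p" "p \<le> C * real n powr (- real d + 1 + \<delta>)"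
    and \<gamma>: "0 < \<gamma>" "\<gamma> = real d - 1 - \<delta> - real (d choose 2) * max (1 - \<delta>) 0"
    and n: "real n powr - \<gamma> \<le> 1/2"
    and B: "B \<in> estimators_W n d"
  shows "1 - (ln C + real d ^ d / cl + real (d choose 2) * ln 2 + ln 2
            + 2 * (C + 2 ^ 2 ^ d * C ^ 2 ^ d) / cl) / (\<gamma> * ln (real n)) \<le> loss_W n d p B"
proof -
  define S where "S = nsets {1..n} d"
  define E where "E = subset_expect S p"
  define W where "W = proj_W n"
  define \<kappa> where "\<kappa> = max (1 - \<delta>) 0"
  define lam where "lam = real n powr - \<kappa>"
  \<comment> \<open>The geometric distribution with mass \<open>(1 - x) * x ^ k\<close> has mean
    \<open>x / (1 - x) = lam\<close>.\<close>
  define x where "x = lam / (1 + lam)"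
  define t where "t = real n powr - \<gamma>"
  define A where "A = C + 2 ^ 2 ^ d * C ^ 2 ^ d"
  define m where "m = real (n choose d) * p"
  define L where "L = ln (real n)"
  define a where "a = E (\<lambda>H. real (card (H - B (W H))))"
  define b where "b = E (\<lambda>H. real (card (B (W H) - H)))"
  have finS: "finite S" by (simp add: S_def finite_imp_finite_nsets)
  have n_pos: "0 < real n" and L: "0 < L" using d by (auto simp: L_def)
  have lam: "0 < lam" using n_pos by (simp add: lam_def)
  then have x: "0 < x" "x < 1" by (auto simp: x_def)
  have t: "0 < t" "t \<le> 1/2" using n n_pos by (auto simp: t_def)
  have m: "0 < m" using d p by (simp add: m_def)
  have ln_t: "- ln t = \<gamma> * L" using n_pos by (simp add: t_def L_def ln_powr)
  have BS: "B (W H) \<subseteq> S" if "H \<subseteq> S" for H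
    using B that by (auto simp: estimators_W_def weighted_projections_def W_def S_def)
  have E_mono: "E f \<le> E g" if "\<And>H. H \<subseteq> S \<Longrightarrow> f H \<le> g H" for f g
    unfolding E_def using that p by (intro subset_expect_mono) auto
  have ab: "0 \<le> a" "0 \<le> b"
    using E_mono[of "\<lambda>_. 0"] subset_expect_const[OF finS, of p 0] by (auto simp: a_def b_def E_def)

  have "E (\<lambda>H. real (card (B (W H)))) \<le> E (\<lambda>H. real (card H) + real (card (B (W H) - H)))"
  proof (rule E_mono)
    fix H assume "H \<subseteq> S"
    then have "finite H" "finite (B (W H))" using BS finS finite_subset by metis+
    then have "card (B (W H)) \<le> card H + card (B (W H) - H)"
      using card_Un_le[of H "B (W H) - H"] card_mono[of "H \<union> B (W H)" "B (W H)"] by simp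
    then show "real (card (B (W H))) \<le> real (card H) + real (card (B (W H) - H))" by linarith
  qed
  then have EB: "E (\<lambda>H. real (card (B (W H)))) \<le> m + b"
    using finS by (simp add: E_def subset_expect_add subset_expect_card m_def b_def S_def)

  have loss: "loss_W n d p B = (a + b) / m"
  proof -
    have "E (\<lambda>H. real (card (sym_diff (B (W H)) H))) =
        E (\<lambda>H. real (card (H - B (W H))) + real (card (B (W H) - H)))"
      unfolding E_def subset_expect_def
    proof (intro sum.cong refl arg_cong2[where f = "(*)"])
      fix H assume "H \<in> Pow S"
      then have "finite H" "finite (B (W H))" using BS finS finite_subset by (metis PowD)+
      then show "real (card (sym_diff (B (W H)) H)) = real (card (H - B (W H))) + real (card (B (W H) - H))"
        by (subst card_Un_disjoint) auto
    qed
    then show ?thesis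
      using p by (simp add: loss_W_eq E_def S_def W_def subset_expect_add a_def b_def m_def mult_ac)
  qed

  have ln_p: "(real d - 1 - \<delta>) * L - ln C \<le> - ln p"
  proof -
    have "ln p \<le> ln (C * real n powr (- real d + 1 + \<delta>))"
      using p p_bounds C n_pos by (subst ln_le_cancel_iff) auto
    also have "\<dots> = ln C + (- real d + 1 + \<delta>) * L"
      using C n_pos by (simp add: ln_mult ln_powr L_def)
    finally show ?thesis by (simp add: algebra_simps)
  qed
  \<comment> \<open>As \<open>\<kappa> \<ge> 1 - \<delta>\<close>, the quantity
    \<open>n ^ 2 * lam\<close> is at most \<open>n powr (1 + \<delta>)\<close>, which is the order
    of \<open>m\<close>.\<close>
  have ln_1x: "real (n choose 2) * - ln (1 - x) \<le> real d ^ d / cl * m"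
  proof -
    have "- ln (1 - x) = ln (1 + lam)"
      using lam by (simp add: x_def diff_divide_eq_iff ln_div)
    also have "\<dots> \<le> lam" using lam by (intro ln_add_one_self_le_self) auto
    finally have "real (n choose 2) * - ln (1 - x) \<le> real n ^ 2 * lam"
      using binomial_le_pow[of 2 n] d lam x by (intro mult_mono) (auto simp flip: of_nat_power)
    also have "\<dots> = real n powr (2 - \<kappa>)"
      using n_pos by (simp add: lam_def powr_diff powr_minus field_simps)
    also have "\<dots> \<le> real n powr (1 + \<delta>)"
      using d by (intro powr_mono) (auto simp: \<kappa>_def)
    also have "\<dots> = real n ^ d * real n powr (- real d + 1 + \<delta>)"
      using n_pos by (simp add: powr_realpow[symmetric] powr_add[symmetric])
    also have "\<dots> \<le> (real d ^ d * real (n choose d)) * (p / cl)"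
      using power_le_mult_binomial[of d n] d p_bounds cl
      by (intro mult_mono) (auto simp: field_simps)
    finally show ?thesis by (simp add: m_def mult_ac)
  qed
  have ln_x: "- ln x \<le> ln 2 + \<kappa> * L"
  proof -
    have "- ln x = ln (1 + 1 / lam)"
      using lam by (simp add: x_def ln_div add_divide_distrib flip: ln_div) (simp add: ln_div field_simps)
    also have "1 + 1 / lam \<le> 2 * real n powr \<kappa>"
      using d ge_one_powr_ge_zero[of "real n" \<kappa>] by (simp add: lam_def powr_minus \<kappa>_def divide_inverse)
    then have "ln (1 + 1 / lam) \<le> ln (2 * real n powr \<kappa>)"
      using lam n_pos by (subst ln_le_cancel_iff) (auto intro: add_pos_pos)
    also have "\<dots> = ln 2 + \<kappa> * L" using n_pos by (simp add: ln_mult ln_powr L_def)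
    finally show ?thesis .
  qed
  have cliques: "2 * t * (\<Sum>h\<in>S. E (\<lambda>H. of_bool (pairs_covered h H))) \<le> 2 * A / cl * m"
  proof -
    have "(\<Sum>h\<in>S. E (\<lambda>H. of_bool (pairs_covered h H))) \<le>
        (\<Sum>h\<in>S. A * real n powr - (real (d choose 2) * \<kappa>))"
      unfolding E_def S_def A_def \<kappa>_def using d \<delta> C p p_bounds
      by (intro sum_mono pairs_covered_prob_le_powr) auto
    then have "2 * t * (\<Sum>h\<in>S. E (\<lambda>H. of_bool (pairs_covered h H))) \<le>
        2 * t * (real (n choose d) * (A * real n powr - (real (d choose 2) * \<kappa>)))"
      using t by (intro mult_left_mono) (auto simp: S_def)
    also have "\<dots> = 2 * A * real (n choose d) * (real n powr - \<gamma> * real n powr - (real (d choose 2) * \<kappa>))"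
      by (simp add: t_def)
    \<comment> \<open>This explains the choice of \<gamma>: \<open>t\<close> times the order of the
      coverage probability is exactly the order of \<open>p\<close>.\<close>
    also have "real n powr - \<gamma> * real n powr - (real (d choose 2) * \<kappa>) = real n powr (- real d + 1 + \<delta>)"
      unfolding powr_add[symmetric] \<gamma>(2) \<kappa>_def by (rule arg_cong[where f = "(powr) (real n)"]) simp
    also have "2 * A * real (n choose d) * \<dots> \<le> 2 * A * real (n choose d) * (p / cl)"
      using p_bounds cl C by (intro mult_left_mono) (auto simp: field_simps A_def)
    finally show ?thesis by (simp add: m_def mult_ac)
  qed

  define K where "K = ln C + real d ^ d / cl + real (d choose 2) * ln 2 + ln 2 + 2 * A / cl"
  have "m * - ln p \<le> real (n choose 2) * - ln (1 - x) + real (d choose 2) * m * - ln x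
      + ln 2 * E (\<lambda>H. real (card (B (W H)))) + \<gamma> * L * a
      + 2 * t * (\<Sum>h\<in>S. E (\<lambda>H. of_bool (pairs_covered h H)))"
    using encoding_bound[OF p x t, of n d B] BS unfolding E_def S_def W_def a_def ln_t m_def by simp
  moreover have "m * ((real d - 1 - \<delta>) * L - ln C) \<le> m * - ln p"
    using ln_p m by (intro mult_left_mono) auto
  moreover have "real (d choose 2) * m * - ln x \<le> real (d choose 2) * m * (ln 2 + \<kappa> * L)"
    using ln_x m by (intro mult_left_mono) auto
  moreover have "ln 2 * E (\<lambda>H. real (card (B (W H)))) \<le> ln 2 * (m + b)"
    using EB by (intro mult_left_mono) auto
  ultimately have "m * ((real d - 1 - \<delta>) * L - ln C) \<le> real d ^ d / cl * m
      + real (d choose 2) * m * (ln 2 + \<kappa> * L) + ln 2 * (m + b) + \<gamma> * L * a + 2 * A / cl * m"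
    using ln_1x cliques by linarith
  then have "m * (\<gamma> * L) - K * m \<le> \<gamma> * L * a + ln 2 * b"
    unfolding K_def \<gamma>(2) \<kappa>_def by (simp add: algebra_simps)
  \<comment> \<open>A restatement of \<open>t \<le> 1/2\<close>. Raising the price of a false output
    to that of a missed hyperedge produces the loss \<open>(a + b) / m\<close>.\<close>
  moreover have "ln 2 * b \<le> \<gamma> * L * b"
  proof (rule mult_right_mono)
    have "ln t \<le> ln (1/2)" using t by (subst ln_le_cancel_iff) auto
    then show "ln 2 \<le> \<gamma> * L" using ln_t by (simp add: ln_div)
  qed (fact ab)
  ultimately have "m * (\<gamma> * L) - K * m \<le> \<gamma> * L * (a + b)" by (simp add: algebra_simps)
  then have "1 - K / (\<gamma> * L) \<le> (a + b) / m"
    using m L \<gamma>(1) by (simp add: field_simps)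
  then show ?thesis by (simp add: loss K_def A_def L_def)
qed

theorem theorem2:
  fixes d :: nat and \<delta> c :: real and p \<epsilon> :: "nat \<Rightarrow> real"
  assumes "d \<ge> 3" and "\<delta> < real d - 1" and "c > 0"
    and "\<epsilon> \<longlonglongrightarrow> 0"
    and "\<forall>\<^sub>F n in sequentially. p n = (c + \<epsilon> n) * real n powr (- real d + 1 + \<delta>)"
  shows "(\<delta> < (real d - 1) / (real d + 1) \<longrightarrow>
            (\<lambda>n. partial_recovery_loss_W n d (p n)) \<longlonglongrightarrow> 0) \<and>
         (\<delta> > (real d - 1) / (real d + 1) \<longrightarrow>
            (\<lambda>n. partial_recovery_loss_W n d (p n)) \<longlonglongrightarrow> 1)"
proof -
  \<comment> \<open>Eventually \<open>c + \<epsilon> n\<close> lies between \<open>c / 2\<close> and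
    \<open>2 * c\<close>; the maximum with 1 is for \<open>prod_trace_le\<close>, where powers of
    \<open>C\<close> must increase.\<close>
  define C where "C = max 1 (2 * c)"
  define cl where "cl = c / 2"
  have C: "1 \<le> C" and cl: "0 < cl" using assms(3) by (auto simp: C_def cl_def)
  have lim_C: "(\<lambda>n. C * real n powr (- real d + 1 + \<delta>)) \<longlonglongrightarrow> 0"
    using assms(2) by (intro tendsto_mult_right_zero tendsto_neg_powr filterlim_real_sequentially) auto
  have "\<forall>\<^sub>F n in sequentially. \<bar>\<epsilon> n\<bar> < c / 2"
    using assms(3,4) tendstoD[of \<epsilon> 0 sequentially "c / 2"] by simp
  with assms(5) order_tendstoD(2)[OF lim_C zero_less_one] eventually_ge_at_top[of d]
  have good: "\<forall>\<^sub>F n in sequentially. d \<le> n \<and> 0 < p n \<and> p n < 1 \<and>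
      cl * real n powr (- real d + 1 + \<delta>) \<le> p n \<and> p n \<le> C * real n powr (- real d + 1 + \<delta>)"
  proof (eventually_elim, goal_cases)
    case (1 n)
    have "0 < real n powr (- real d + 1 + \<delta>)" using 1 assms(1) by simp
    moreover have "cl \<le> c + \<epsilon> n" "c + \<epsilon> n \<le> C" using 1 by (auto simp: cl_def C_def)
    ultimately have "cl * real n powr (- real d + 1 + \<delta>) \<le> p n" "p n \<le> C * real n powr (- real d + 1 + \<delta>)"
        "0 < cl * real n powr (- real d + 1 + \<delta>)"
      using 1 cl by (auto intro!: mult_right_mono)
    then show ?case using 1 by linarith
  qed

  have "(\<lambda>n. partial_recovery_loss_W n d (p n)) \<longlonglongrightarrow> 0"
    if sub: "\<delta> < (real d - 1) / (real d + 1)"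
  proof (rule tendsto_sandwich)
    show "\<forall>\<^sub>F n in sequentially. 0 \<le> partial_recovery_loss_W n d (p n)"
      using good by eventually_elim (auto intro: partial_recovery_loss_W_nonneg)
    show "\<forall>\<^sub>F n in sequentially. partial_recovery_loss_W n d (p n) \<le>
        2 ^ 2 ^ d * C ^ 2 ^ d / cl * real n powr - ((real d - 1) / (real d + 1) - \<delta>)"
      using good
    proof eventually_elim
      case (elim n)
      then show ?case
        using assms(1) sub C cl by (intro partial_recovery_loss_W_le_powr) auto
    qed
    show "(\<lambda>n. 2 ^ 2 ^ d * C ^ 2 ^ d / cl * real n powr - ((real d - 1) / (real d + 1) - \<delta>)) \<longlonglongrightarrow> 0"
      using sub by (intro tendsto_mult_right_zero tendsto_neg_powr filterlim_real_sequentially) auto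
  qed simp
  moreover have "(\<lambda>n. partial_recovery_loss_W n d (p n)) \<longlonglongrightarrow> 1"
    if super: "\<delta> > (real d - 1) / (real d + 1)"
  proof -
    define \<gamma> where "\<gamma> = real d - 1 - \<delta> - real (d choose 2) * max (1 - \<delta>) 0"
    define K where "K = ln C + real d ^ d / cl + real (d choose 2) * ln 2 + ln 2
            + 2 * (C + 2 ^ 2 ^ d * C ^ 2 ^ d) / cl"
    \<comment> \<open>For \<open>\<delta> \<le> 1\<close> this is \<open>choose_2_mult_less\<close>;
      for \<open>\<delta> > 1\<close> the maximum vanishes and \<open>\<delta> < d - 1\<close>
      suffices.\<close>
    have \<gamma>: "0 < \<gamma>"
      using choose_2_mult_less[OF super assms(1)] assms(2) by (auto simp: \<gamma>_def max_def)
    have "(\<lambda>n. real n powr - \<gamma>) \<longlonglongrightarrow> 0"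
      using \<gamma> by (intro tendsto_neg_powr filterlim_real_sequentially) auto
    then have small: "\<forall>\<^sub>F n in sequentially. real n powr - \<gamma> < 1/2"
      by (rule order_tendstoD) simp
    show ?thesis
    proof (rule tendsto_sandwich)
      show "\<forall>\<^sub>F n in sequentially. 1 - K / (\<gamma> * ln (real n)) \<le> partial_recovery_loss_W n d (p n)"
        using good small
      proof eventually_elim
        case (elim n)
        have "1 - K / (\<gamma> * ln (real n)) \<le> loss_W n d (p n) B" if "B \<in> estimators_W n d" for B
          unfolding K_def
          by (rule loss_W_ge[OF assms(1) _ super C cl _ _ _ _ \<gamma> \<gamma>_def _ that]) (use elim in auto)
        then show ?case
          using finite_estimators_W estimators_W_nonempty by (simp add: partial_recovery_loss_W_def)
      qed
      show "\<forall>\<^sub>F n in sequentially. partial_recovery_loss_W n d (p n) \<le> 1"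
        using good by eventually_elim (auto intro: partial_recovery_loss_W_le_1)
      have "filterlim (\<lambda>n. \<gamma> * ln (real n)) at_top sequentially"
        using \<gamma> by (intro filterlim_tendsto_pos_mult_at_top[OF tendsto_const]
          filterlim_compose[OF ln_at_top] filterlim_real_sequentially)
      then have "(\<lambda>n. K / (\<gamma> * ln (real n))) \<longlonglongrightarrow> 0"
        by (intro tendsto_divide_0[OF tendsto_const] filterlim_at_top_imp_at_infinity)
      then show "(\<lambda>n. 1 - K / (\<gamma> * ln (real n))) \<longlonglongrightarrow> 1"
        using tendsto_diff[OF tendsto_const, of _ 0 _ 1] by simp
    qed simp
  qed
  ultimately show ?thesis by blast
qed

end
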